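(* Let $I\subset T_n$ be a nonzero monomial ideal, let $d=\deg(I)$, and let $t\ge n$ be an integer. Consider the $K$-algebra map $$\Phi_t:T_{nd}\to T_{td},\qquad \Phi_t(x_j):=x_{\varphi(j,t)}\ \text{ for } 1\le j\le nd,\qquad \varphi(j,t):=\left\lfloor\frac{j-1}{n}\right\rfloor (t-n)+j.$$ Then $I^{\sigma^t}=\Phi_t(I^{\sigma^n})$ as ideals in $T_{td}$, i.e. $I^{\sigma^t}$ is the ideal of $T_{td}$ generated by $\Phi_t(I^{\sigma^n})$.
   Context: $K$ is a field, $T=K[x_1,x_2,\ldots]$ and $T_n=K[x_1,\ldots,x_n]$. For a monomial $u=x_{i_1}\cdots x_{i_d}$ with $i_1\le\cdots\le i_d$, set $\sigma(u):=x_{i_1}x_{i_2+1}\cdots x_{i_d+d-1}$, and $\sigma^t(u):=\sigma(\sigma^{t-1}(u))$, so $\sigma^t(u)=x_{i_1}x_{i_2+t}\cdots x_{i_d+(d-1)t}$. For a nonzero monomial ideal $I$, $G(I)$ is its set of minimal monomial generators and $\deg(I)$ is the maximal degree of an element of $G(I)$. $I^\sigma$ is the ideal generated by $\sigma(u)$, $u\in G(I)$, for which $G(I^\sigma)=\{\sigma(u):u\in G(I)\}$; $I^{\sigma^t}:=(I^{\sigma^{t-1}})^\sigma$, so $I^{\sigma^t}$ is generated by $\sigma^t(u)$, $u\in G(I)$. For $t\ge n$ and $I\subset T_n$ with $\deg(I)=d$, $I^{\sigma^t}$ is considered as an ideal of $T_{td}$. *)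

theory Defs
  imports "HOL-Algebra.RingHom" "HOL-Library.Poly_Mapping" "HOL-Library.Multiset"
begin

(* A monomial x_{i_1} ... x_{i_d} is the multiset of its variable indices {#i_1, ..., i_d#}: the product
   of monomials is +, divisibility is \<subseteq>#, and the degree is size.  With the convolution product of
   Poly_Mapping, the type below is the polynomial ring over 'k in the variables x_i (i :: nat). *)
type_synonym 'k mpoly = "nat multiset \<Rightarrow>\<^sub>0 'k"

definition xmon :: "nat multiset \<Rightarrow> 'k::field mpoly" where
  "xmon u = Poly_Mapping.single u 1"

abbreviation Var :: "nat \<Rightarrow> 'k::field mpoly" where
  "Var i \<equiv> xmon {#i#}"

abbreviation Const :: "'k::field \<Rightarrow> 'k mpoly" where
  "Const c \<equiv> Poly_Mapping.single {#} c"

(* T_N = K[x_1, ..., x_N] as a structure, so that ideals and ring homomorphisms relative to T_N are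
   those of HOL-Algebra. *)
definition T_ring :: "nat \<Rightarrow> 'k::field mpoly ring" where
  "T_ring N = \<lparr>carrier = {p. \<forall>u\<in>Poly_Mapping.keys p. set_mset u \<subseteq> {1..N}},
          monoid.mult = (*), one = 1, zero = 0, add = (+)\<rparr>"

definition monomial_ideal :: "nat \<Rightarrow> 'k::field mpoly set \<Rightarrow> bool" where
  "monomial_ideal N I \<longleftrightarrow>
     (\<exists>S. (\<forall>u\<in>S. set_mset u \<subseteq> {1..N}) \<and> I = Idl\<^bsub>T_ring N\<^esub> (xmon ` S))"

(* G(I), as multisets: the monomials of I that are minimal with respect to divisibility.  By
   Idl_min_gens and min_gens_least below, for a monomial ideal this is the least set of monomials
   generating I; it is finite by finite_min_gens, so that the Max in deg_ideal is a maximum. *)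
definition min_gens :: "'k::field mpoly set \<Rightarrow> nat multiset set" where
  "min_gens I = {u. (xmon u :: 'k mpoly) \<in> I \<and> (\<forall>v. (xmon v :: 'k mpoly) \<in> I \<longrightarrow> v \<subseteq># u \<longrightarrow> v = u)}"

definition deg_ideal :: "'k::field mpoly set \<Rightarrow> nat" where
  "deg_ideal I = Max (size ` min_gens I)"

(* With i_1 \<le> ... \<le> i_d the sorted list of indices of u, the index i_k is replaced by i_k + (k - 1). *)
definition sigma :: "nat multiset \<Rightarrow> nat multiset" where
  "sigma u = mset (map2 (+) (sorted_list_of_multiset u) [0..<size u])"

(* I^\<sigma> as an ideal of T_N.  Since min_gens I depends only on the set I, the ideal I itself may live in
   a smaller polynomial ring than T_N. *)
definition sigma_ideal :: "nat \<Rightarrow> 'k::field mpoly set \<Rightarrow> 'k mpoly set" where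
  "sigma_ideal N I = Idl\<^bsub>T_ring N\<^esub> (xmon ` sigma ` min_gens I)"

definition sigma_pow_ideal :: "nat \<Rightarrow> nat \<Rightarrow> 'k::field mpoly set \<Rightarrow> 'k mpoly set" where
  "sigma_pow_ideal N t I = (sigma_ideal N ^^ t) I"

(* The ideal of T_N generated by the \<sigma>^t(u), u \<in> G(I).  It equals sigma_pow_ideal if no \<sigma>(u) divides
   another at any step (e.g. for strongly stable I), but not always: for I = (x_2, x_1^2), t = 2, it is
   (x_2, x_1 x_3), whereas I^\<sigma> = (x_2, x_1 x_2) = (x_2) and so (I^\<sigma>)^\<sigma> = (x_2). *)
definition sigma_pow_gen_ideal :: "nat \<Rightarrow> nat \<Rightarrow> 'k::field mpoly set \<Rightarrow> 'k mpoly set" where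
  "sigma_pow_gen_ideal N t I = Idl\<^bsub>T_ring N\<^esub> (xmon ` (sigma ^^ t) ` min_gens I)"

(* The K-algebra homomorphisms from T_M to T_N.  By K_alg_hom_exists, the images of the variables
   can be prescribed; values of \<Phi> outside T_M are unconstrained. *)
definition K_alg_hom :: "nat \<Rightarrow> nat \<Rightarrow> ('k::field mpoly \<Rightarrow> 'k mpoly) \<Rightarrow> bool" where
  "K_alg_hom M N \<Phi> \<longleftrightarrow> \<Phi> \<in> ring_hom (T_ring M) (T_ring N) \<and> (\<forall>c. \<Phi> (Const c) = Const c)"

(* The subtraction of nat does not truncate for j \<ge> 1 and t \<ge> n. *)
definition phi :: "nat \<Rightarrow> nat \<Rightarrow> nat \<Rightarrow> nat" where
  "phi n j t = ((j - 1) div n) * (t - n) + j"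


lemma carrier_T_ring: "p \<in> carrier (T_ring N) \<longleftrightarrow> (\<forall>u\<in>Poly_Mapping.keys p. set_mset u \<subseteq> {1..N})"
  and T_ring_simps [simp]: "monoid.mult (T_ring N) = (*)"
      "one (T_ring N) = 1" "zero (T_ring N) = 0" "add (T_ring N) = (+)"
  by (simp_all add: T_ring_def)

lemma mult_in_T_ring:
  "p \<in> carrier (T_ring N) \<Longrightarrow> q \<in> carrier (T_ring N) \<Longrightarrow> p * q \<in> carrier (T_ring N)"
  using keys_mult[of p q] by (fastforce simp: carrier_T_ring)

lemma xmon_carrier [simp]: "(xmon u :: 'k::field mpoly) \<in> carrier (T_ring N) \<longleftrightarrow> set_mset u \<subseteq> {1..N}"
  by (simp add: carrier_T_ring xmon_def)

lemma xmon_add: "xmon (u + v) = xmon u * (xmon v :: 'k::field mpoly)"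
  by (simp add: xmon_def mult_single)

lemma cring_T_ring: "cring (T_ring N :: 'k::field mpoly ring)"
proof (rule cringI)
  show "abelian_group (T_ring N :: 'k mpoly ring)"
  proof (rule abelian_groupI)
    fix x y :: "'k mpoly"
    assume "x \<in> carrier (T_ring N)" "y \<in> carrier (T_ring N)"
    then show "x \<oplus>\<^bsub>T_ring N\<^esub> y \<in> carrier (T_ring N)"
      using keys_add[of x y] by (auto simp: carrier_T_ring)
  next
    fix x :: "'k mpoly"
    assume "x \<in> carrier (T_ring N)"
    then show "\<exists>y\<in>carrier (T_ring N). y \<oplus>\<^bsub>T_ring N\<^esub> x = \<zero>\<^bsub>T_ring N\<^esub>"
      by (intro bexI[of _ "-x"]) (auto simp: carrier_T_ring)
  qed (auto simp: carrier_T_ring algebra_simps)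
  show "Group.comm_monoid (T_ring N :: 'k mpoly ring)"
    by (rule Group.comm_monoidI) (auto simp: mult_in_T_ring algebra_simps, simp add: carrier_T_ring)
qed (auto simp: algebra_simps)

lemma T_ring_minus:
  assumes "p \<in> carrier (T_ring N)" shows "a_inv (T_ring N) p = - (p :: 'k::field mpoly)"
proof -
  interpret cring "T_ring N :: 'k mpoly ring" by (rule cring_T_ring)
  show ?thesis using assms by (intro minus_equality) (auto simp: carrier_T_ring)
qed

lemma monomials_divisible_ideal:
  "ideal {p \<in> carrier (T_ring N). \<forall>u\<in>Poly_Mapping.keys (p :: 'k::field mpoly). \<exists>s\<in>S. s \<subseteq># u} (T_ring N)"
    (is "ideal ?J _")
proof -
  interpret cring "T_ring N :: 'k mpoly ring" by (rule cring_T_ring)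
  have mul: "x * a \<in> ?J" if "a \<in> ?J" "x \<in> carrier (T_ring N)" for a x
  proof -
    have "\<exists>s\<in>S. s \<subseteq># u" if "u \<in> Poly_Mapping.keys (x * a)" for u
    proof -
      obtain v w where "u = v + w" "w \<in> Poly_Mapping.keys a"
        using \<open>u \<in> _\<close> keys_mult[of x a] by auto
      then show ?thesis using \<open>a \<in> ?J\<close> subset_mset.add_increasing by fastforce
    qed
    then show ?thesis using that by (simp add: mult_in_T_ring)
  qed
  show ?thesis
  proof (rule idealI)
    show "subgroup ?J (add_monoid (T_ring N))"
    proof (rule add.subgroupI)
      show "?J \<noteq> {}" by (auto intro!: exI[of _ 0] simp: carrier_T_ring)
    next
      fix a b :: "'k mpoly"
      assume "a \<in> ?J" "b \<in> ?J"
      then show "a \<oplus>\<^bsub>T_ring N\<^esub> b \<in> ?J"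
        using keys_add[of a b] by (simp add: carrier_T_ring) (meson UnE subsetD)
    qed (auto simp: T_ring_minus carrier_T_ring)
  qed (use mul in \<open>auto simp: mult.commute ring_axioms\<close>)
qed

lemma xmon_in_IdlD:
  assumes "\<forall>u\<in>S. set_mset u \<subseteq> {1..N}" "(xmon u :: 'k::field mpoly) \<in> Idl\<^bsub>T_ring N\<^esub> (xmon ` S)"
  shows "\<exists>s\<in>S. s \<subseteq># u"
proof -
  interpret cring "T_ring N :: 'k mpoly ring" by (rule cring_T_ring)
  have "Idl\<^bsub>T_ring N\<^esub> (xmon ` S :: 'k mpoly set) \<subseteq>
      {p \<in> carrier (T_ring N). \<forall>u\<in>Poly_Mapping.keys (p :: 'k::field mpoly). \<exists>s\<in>S. s \<subseteq># u}"
    by (rule genideal_minimal[OF monomials_divisible_ideal]) (use assms(1) in \<open>auto simp: xmon_def carrier_T_ring\<close>)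
  then show ?thesis using assms(2) by (auto simp: xmon_def)
qed

lemma min_gens_below:
  assumes "(xmon u :: 'k::field mpoly) \<in> I"
  shows "\<exists>g\<in>min_gens I. g \<subseteq># u"
  using assms
proof (induction "size u" arbitrary: u rule: less_induct)
  case less
  show ?case
  proof (cases "u \<in> min_gens I")
    case False
    then obtain v where "(xmon v :: 'k mpoly) \<in> I" "v \<subset># u"
      using less.prems by (auto simp: min_gens_def subset_mset.less_le)
    then show ?thesis
      using less.hyps[of v] by (meson mset_subset_size subset_mset.less_imp_le subset_mset.trans)
  qed auto
qed

lemma min_gens_least:
  assumes "\<forall>u\<in>S. set_mset u \<subseteq> {1..N}"
  shows "min_gens (Idl\<^bsub>T_ring N\<^esub> (xmon ` S) :: 'k::field mpoly set) \<subseteq> S"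
proof
  interpret cring "T_ring N :: 'k mpoly ring" by (rule cring_T_ring)
  fix u assume u: "u \<in> min_gens (Idl\<^bsub>T_ring N\<^esub> (xmon ` S) :: 'k mpoly set)"
  then obtain s where "s \<in> S" "s \<subseteq># u"
    using xmon_in_IdlD[OF assms] by (auto simp: min_gens_def)
  moreover have "(xmon s :: 'k mpoly) \<in> Idl\<^bsub>T_ring N\<^esub> (xmon ` S)"
    using genideal_self[of "xmon ` S :: 'k mpoly set"] assms \<open>s \<in> S\<close>
    by (metis (no_types, lifting) image_subset_iff xmon_carrier)
  ultimately show "u \<in> S" using u by (auto simp: min_gens_def)
qed

lemma Idl_min_gens:
  assumes "monomial_ideal N (I :: 'k::field mpoly set)"
  shows "Idl\<^bsub>T_ring N\<^esub> (xmon ` min_gens I) = I"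
proof -
  interpret cring "T_ring N :: 'k mpoly ring" by (rule cring_T_ring)
  obtain S where S: "\<forall>u\<in>S. set_mset u \<subseteq> {1..N}" "I = Idl\<^bsub>T_ring N\<^esub> (xmon ` S)"
    using assms by (auto simp: monomial_ideal_def)
  have GS: "min_gens I \<subseteq> S" using min_gens_least[OF S(1)] S(2) by simp
  have SC: "xmon ` S \<subseteq> (carrier (T_ring N) :: 'k mpoly set)" using S(1) by auto
  have GC: "xmon ` min_gens I \<subseteq> (carrier (T_ring N) :: 'k mpoly set)" using SC GS by blast
  interpret J: ideal "Idl\<^bsub>T_ring N\<^esub> (xmon ` min_gens I :: 'k mpoly set)" "T_ring N" by (rule genideal_ideal[OF GC])
  have "(xmon s :: 'k mpoly) \<in> Idl\<^bsub>T_ring N\<^esub> (xmon ` min_gens I)" if "s \<in> S" for s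
  proof -
    have "(xmon s :: 'k mpoly) \<in> I" using genideal_self[OF SC] S(2) that by auto
    then obtain g where g: "g \<in> min_gens I" "g \<subseteq># s" using min_gens_below by blast
    have "(xmon g :: 'k mpoly) \<in> Idl\<^bsub>T_ring N\<^esub> (xmon ` min_gens I)" using genideal_self[OF GC] g by auto
    moreover have "(xmon (s - g) :: 'k mpoly) \<in> carrier (T_ring N)"
      using S(1) that by (auto dest!: in_diffD)
    ultimately have "xmon (s - g) * xmon g \<in> (Idl\<^bsub>T_ring N\<^esub> (xmon ` min_gens I) :: 'k mpoly set)"
      using J.I_l_closed by fastforce
    then show ?thesis using g(2) by (simp flip: xmon_add)
  qed
  then have "I \<subseteq> Idl\<^bsub>T_ring N\<^esub> (xmon ` min_gens I)"
    unfolding S(2) by (intro genideal_minimal) (auto simp: genideal_ideal GC simp flip: S(2))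
  moreover have "Idl\<^bsub>T_ring N\<^esub> (xmon ` min_gens I) \<subseteq> I"
    unfolding S(2) using SC GS S(2) by (intro subset_Idl_subset) auto
  ultimately show ?thesis by blast
qed

(* Dickson's lemma, for sequences of monomials in finitely many variables. *)
lemma dickson_seq:
  fixes f :: "nat \<Rightarrow> nat multiset"
  shows "\<exists>r :: nat \<Rightarrow> nat. strict_mono r \<and> (\<forall>j\<in>{1..N}. mono (\<lambda>k. count (f (r k)) j))"
proof (induction N)
  case 0
  show ?case by (intro exI[of _ id]) (auto simp: strict_mono_def)
next
  case (Suc N)
  then obtain r :: "nat \<Rightarrow> nat" where r: "strict_mono r" "\<forall>j\<in>{1..N}. mono (\<lambda>k. count (f (r k)) j)" by blast
  let ?g = "\<lambda>k. count (f (r k)) (Suc N)"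
  obtain s :: "nat \<Rightarrow> nat" where s: "strict_mono s" "mono (\<lambda>k. ?g (s k))"
  proof -
    define s where "s = rec_nat (ARG_MIN ?g k. True) (\<lambda>_ m. ARG_MIN ?g k. k > m)"
    have s0: "?g (s 0) \<le> ?g k" for k
      using arg_min_nat_le[of "\<lambda>_. True" k ?g] by (simp add: s_def)
    have sS: "s (Suc n) > s n" "\<And>k. k > s n \<Longrightarrow> ?g (s (Suc n)) \<le> ?g k" for n
      using arg_min_nat_lemma[of "\<lambda>k. k > s n" "Suc (s n)" ?g] by (auto simp: s_def)
    have "strict_mono s" using sS(1) by (simp add: strict_mono_Suc_iff)
    moreover have "?g (s n) \<le> ?g (s (Suc n))" for n
      using s0 sS by (cases n) (auto, meson less_trans)
    ultimately show ?thesis using that by (simp add: mono_iff_le_Suc)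
  qed
  have "mono (\<lambda>k. count (f (r (s k))) j)" if "j \<in> {1..Suc N}" for j
  proof (cases "j = Suc N")
    case False
    then have "mono (\<lambda>k. count (f (r k)) j)" using r(2) that by auto
    then show ?thesis using s(1) by (auto simp: mono_def strict_mono_less_eq)
  qed (use s(2) in auto)
  then show ?case
    using r(1) s(1) by (intro exI[of _ "r \<circ> s"]) (auto simp: strict_mono_def)
qed

lemma finite_min_gens:
  assumes "monomial_ideal N (I :: 'k::field mpoly set)"
  shows "finite (min_gens I)"
proof (rule ccontr)
  assume "infinite (min_gens I)"
  then obtain f :: "nat \<Rightarrow> nat multiset" where f: "inj f" "range f \<subseteq> min_gens I"
    using infinite_countable_subset by blast
  obtain S where S: "\<forall>u\<in>S. set_mset u \<subseteq> {1..N}" "I = Idl\<^bsub>T_ring N\<^esub> (xmon ` S)"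
    using assms by (auto simp: monomial_ideal_def)
  have fS: "set_mset (f k) \<subseteq> {1..N}" for k
    using S(1) min_gens_least[OF S(1), where 'k = 'k] f(2) S(2) by blast
  obtain r :: "nat \<Rightarrow> nat" where r: "strict_mono r" "\<forall>j\<in>{1..N}. mono (\<lambda>k. count (f (r k)) j)"
    using dickson_seq by blast
  have "f (r 0) \<subseteq># f (r 1)"
  proof (rule mset_subset_eqI)
    fix j show "count (f (r 0)) j \<le> count (f (r 1)) j"
    proof (cases "j \<in> {1..N}")
      case True then show ?thesis using r(2) by (auto simp: mono_def)
    next
      case False then have "count (f (r 0)) j = 0" using fS by (meson not_in_iff subsetD)
      then show ?thesis by simp
    qed
  qed
  moreover have "f (r 0) \<in> min_gens I" "f (r 1) \<in> min_gens I" using f(2) by auto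
  ultimately have "f (r 0) = f (r 1)" by (auto simp: min_gens_def)
  then show False using f(1) strict_monoD[OF r(1), of 0 1] by (auto dest: injD)
qed

lemma K_alg_hom_exists:
  assumes "\<And>j. j \<in> {1..M} \<Longrightarrow> f j \<in> {1..N}"
  shows "\<exists>\<Phi> :: 'k::field mpoly \<Rightarrow> 'k mpoly. K_alg_hom M N \<Phi> \<and> (\<forall>j\<in>{1..M}. \<Phi> (Var j) = Var (f j))"
proof -
  define F :: "'k mpoly \<Rightarrow> 'k mpoly" where
    "F p = (\<Sum>u\<in>Poly_Mapping.keys p. Poly_Mapping.single (image_mset f u) (Poly_Mapping.lookup p u))" for p
  have F_sup: "F p = (\<Sum>u\<in>A. Poly_Mapping.single (image_mset f u) (Poly_Mapping.lookup p u))"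
    if "finite A" "Poly_Mapping.keys p \<subseteq> A" for p A
    unfolding F_def using that by (intro sum.mono_neutral_left) (auto simp: in_keys_iff)
  have F_add: "F (p + q) = F p + F q" for p q
  proof -
    let ?A = "Poly_Mapping.keys p \<union> Poly_Mapping.keys q"
    show ?thesis using keys_add[of p q]
      by (subst (1 2 3) F_sup[of ?A]) (auto simp: lookup_add single_add sum.distrib)
  qed
  have F_0: "F 0 = 0" by (simp add: F_def)
  have F_single: "F (Poly_Mapping.single u c) = Poly_Mapping.single (image_mset f u) c" for u c
    by (subst F_sup[of "{u}"]) auto
  have F_sum: "F (sum g A) = (\<Sum>x\<in>A. F (g x))" for g and A :: "nat multiset set"
    by (induction A rule: infinite_finite_induct) (auto simp: F_0 F_add)
  have expand: "p = (\<Sum>u\<in>Poly_Mapping.keys p. Poly_Mapping.single u (Poly_Mapping.lookup p u))" for p :: "'k mpoly"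
    by (rule poly_mapping_eqI) (auto simp: lookup_sum lookup_single when_def in_keys_iff)
  have F_mult: "F (p * q) = F p * F q" for p q
  proof -
    let ?s = "\<lambda>p u. Poly_Mapping.single u (Poly_Mapping.lookup p u) :: 'k mpoly"
    have "F (p * q) = F ((\<Sum>u\<in>Poly_Mapping.keys p. ?s p u) * (\<Sum>v\<in>Poly_Mapping.keys q. ?s q v))"
      by (intro arg_cong[where f = F] arg_cong2[where f = "(*)"] expand)
    also have "\<dots> = (\<Sum>u\<in>Poly_Mapping.keys p. \<Sum>v\<in>Poly_Mapping.keys q. F (?s p u * ?s q v))"
      by (simp only: sum_product F_sum)
    also have "\<dots> = (\<Sum>u\<in>Poly_Mapping.keys p. \<Sum>v\<in>Poly_Mapping.keys q.
        Poly_Mapping.single (image_mset f u) (Poly_Mapping.lookup p u) *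
        Poly_Mapping.single (image_mset f v) (Poly_Mapping.lookup q v))"
      by (simp only: mult_single F_single image_mset_union)
    also have "\<dots> = F p * F q"
      by (simp only: F_def sum_product)
    finally show ?thesis .
  qed
  have F_carrier: "F p \<in> carrier (T_ring N)" if "p \<in> carrier (T_ring M)" for p
  proof -
    have "Poly_Mapping.keys (F p) \<subseteq> image_mset f ` Poly_Mapping.keys p"
      unfolding F_def
      by (rule order_trans[OF Poly_Mapping.keys_sum]) auto
    moreover have "set_mset (image_mset f u) \<subseteq> {1..N}" if "u \<in> Poly_Mapping.keys p" for u
    proof -
      have "set_mset u \<subseteq> {1..M}"
        using \<open>p \<in> carrier (T_ring M)\<close> that by (simp add: carrier_T_ring)
      then show ?thesis
        unfolding set_image_mset using assms by (intro image_subsetI) blast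
    qed
    ultimately show ?thesis
      unfolding carrier_T_ring by blast
  qed
  have "F \<in> ring_hom (T_ring M) (T_ring N)"
    using F_single[of "{#}" 1] by (intro ring_hom_memI) (auto simp: F_carrier F_mult F_add single_one)
  then have "K_alg_hom M N F" by (simp add: K_alg_hom_def F_single)
  moreover have "F (Var j) = Var (f j)" for j by (simp add: xmon_def F_single)
  ultimately show ?thesis by blast
qed

end

theory Submission
  imports Defs
begin

text \<open>
  The \<open>k\<close>-th smallest index \<open>i\<close> (counting from 0) of a monomial \<open>u\<close> becomes \<open>i + k * t\<close> in
  \<open>\<sigma>\<^sup>t(u)\<close>. If all indices of \<open>u\<close> lie in \<open>{1..n}\<close> and \<open>t \<ge> n\<close>, then \<open>i + k * t\<close> lies in the \<open>k\<close>-th block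
  of length \<open>t\<close>, so that \<open>k\<close> and \<open>i\<close> can be recovered from it by division by \<open>t\<close>. Two consequences
  carry the proof.

  First, \<open>\<phi>\<close> moves the \<open>k\<close>-th block of length \<open>n\<close> to the start of the \<open>k\<close>-th block of length \<open>t\<close>, and
  hence \<open>\<Phi>\<close> maps \<open>\<sigma>\<^sup>n(u)\<close> to \<open>\<sigma>\<^sup>t(u)\<close> (\<open>image_phi_sigma_pow\<close>, \<open>K_alg_hom_xmon\<close>). Extending the image
  of an ideal to an ideal is the same as extending the images of its generators
  (\<open>Idl_image_Idl\<close>), which settles the ideals generated by all \<open>\<sigma>\<^sup>t(u)\<close> with \<open>u\<close> in \<open>G(I)\<close>, and more
  generally with \<open>u\<close> in a fixed subset \<open>A\<close> of \<open>G(I)\<close> (\<open>Idl_sigma_pow_image\<close>).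

  Second, reduction modulo \<open>t\<close> recovers \<open>u\<close> from \<open>\<sigma>\<^sup>t(u)\<close>, so that \<open>\<sigma>\<^sup>t(v)\<close> divides \<open>\<sigma>\<^sup>t(u)\<close> only if \<open>v\<close>
  divides \<open>u\<close> (\<open>sigma_pow_dvdD\<close>). In the iterated construction, generators of \<open>I\<close> may become
  redundant during the first steps; but from step \<open>n\<close> on, distinct elements of \<open>G(I)\<close> have
  incomparable images, and no further generator is lost. So a single set \<open>A\<close> of surviving
  generators serves for both \<open>n\<close> and \<open>t\<close> (\<open>iterated_minimal_stable\<close>). This set does not depend on the
  ambient polynomial ring, as the minimal generators at each step are found by
  comparing monomials only (\<open>min_gens_sigma_pow_ideal\<close>).
\<close>

section \<open>Powers of the shift operator on monomials\<close>

lemma length_sorted_list_of_multiset [simp]: "length (sorted_list_of_multiset u) = size u"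
  by (metis mset_sorted_list_of_multiset size_mset)

lemma sigma_pow_eq:
  "(sigma ^^ t) u = mset (map (\<lambda>k. sorted_list_of_multiset u ! k + k * t) [0..<size u])"
proof (induction t)
  case 0
  have "map (\<lambda>k. sorted_list_of_multiset u ! k) [0..<size u] = sorted_list_of_multiset u"
    using map_nth[of "sorted_list_of_multiset u"] by simp
  then show ?case by (simp add: mset_map[symmetric] del: mset_map)
next
  case (Suc t)
  define xs where "xs = sorted_list_of_multiset u"
  define ys where "ys = map (\<lambda>k. xs ! k + k * t) [0..<size u]"
  have len: "length xs = size u" by (simp add: xs_def)
  have "sorted xs" by (simp add: xs_def)
  \<comment> \<open>The shifted indices are still in increasing order, so the next \<open>\<sigma>\<close> numbers them as before.\<close>
  then have "sorted ys"
    by (auto simp: ys_def len sorted_iff_nth_mono intro!: add_mono mult_right_mono)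
  then have "sorted_list_of_multiset (mset ys) = ys" by (simp add: sorted_sort_id)
  then have "sigma (mset ys) = mset (map2 (+) ys [0..<size u])"
    by (simp add: sigma_def ys_def)
  also have "map2 (+) ys [0..<size u] = map (\<lambda>k. xs ! k + k * Suc t) [0..<size u]"
    by (rule nth_equalityI) (auto simp: ys_def)
  finally show ?case using Suc by (simp add: xs_def ys_def del: mset_map)
qed

text \<open>Both the map \<open>\<phi>\<close>, which takes \<open>\<sigma>\<^sup>n(u)\<close> to \<open>\<sigma>\<^sup>t(u)\<close>, and the reduction of indices that takes \<open>\<sigma>\<^sup>s(u)\<close>
  back to \<open>u = \<sigma>\<^sup>0(u)\<close> are instances of the following relabelling.\<close>

lemma image_sigma_pow:
  assumes "\<And>i k. i \<in># u \<Longrightarrow> k < size u \<Longrightarrow> f (i + k * s) = i + k * t"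
  shows "image_mset f ((sigma ^^ s) u) = (sigma ^^ t) u"
proof -
  have "f (sorted_list_of_multiset u ! k + k * s) = sorted_list_of_multiset u ! k + k * t"
    if "k < size u" for k
  proof (rule assms)
    show "sorted_list_of_multiset u ! k \<in># u"
      using nth_mem[of k "sorted_list_of_multiset u"] that by simp
  qed (use that in auto)
  then show ?thesis
    unfolding sigma_pow_eq mset_map[symmetric] map_map
    by (intro arg_cong[where f = mset] map_cong) auto
qed

lemma sigma_pow_range:
  assumes "set_mset u \<subseteq> {1..n}" "size u \<le> d" "s \<le> t" "n \<le> t"
  shows "set_mset ((sigma ^^ s) u) \<subseteq> {1..t * d}"
proof
  fix x assume "x \<in># (sigma ^^ s) u"
  then obtain k where k: "k < size u" and x: "x = sorted_list_of_multiset u ! k + k * s"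
    by (auto simp: sigma_pow_eq)
  have "sorted_list_of_multiset u ! k \<in> {1..n}"
    using nth_mem[of k "sorted_list_of_multiset u"] k assms(1) by auto
  moreover have "k * s \<le> k * t" using assms(3) by simp
  moreover have "t * Suc k \<le> t * d" using k assms(2) by (intro mult_le_mono2) simp
  then have "t + k * t \<le> t * d" by (simp add: mult.commute)
  ultimately show "x \<in> {1..t * d}" using x assms(4) unfolding atLeastAtMost_iff by linarith
qed

lemma image_phi_sigma_pow:
  assumes "set_mset u \<subseteq> {1..n}" "n \<le> t"
  shows "image_mset (\<lambda>j. phi n j t) ((sigma ^^ n) u) = (sigma ^^ t) u"
proof (rule image_sigma_pow)
  fix i k assume "i \<in># u" "k < size u"
  then have i: "1 \<le> i" "i \<le> n" using assms(1) by auto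
  have "(i + k * n - 1) div n = ((i - 1) + k * n) div n"
    using i by (intro arg_cong[where f = "\<lambda>x. x div n"]) simp
  also have "\<dots> = k" using i by (subst div_mult_self1) auto
  finally have "phi n (i + k * n) t = i + (k * (t - n) + k * n)" by (simp add: phi_def)
  also have "k * (t - n) + k * n = k * t" using assms(2) by (simp flip: distrib_left)
  finally show "phi n (i + k * n) t = i + k * t" .
qed

text \<open>Undoing \<open>\<sigma>\<^sup>s\<close> by reducing each index modulo \<open>s\<close>, with representatives in \<open>{1..s}\<close>, is a
  homomorphism of monomials and so preserves divisibility.\<close>

lemma sigma_pow_dvdD:
  assumes "set_mset u \<subseteq> {1..n}" "set_mset v \<subseteq> {1..n}" "n \<le> s"
    and "(sigma ^^ s) v \<subseteq># (sigma ^^ s) u"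
  shows "v \<subseteq># u"
proof -
  let ?f = "\<lambda>x. Suc ((x - 1) mod s)"
  have decode: "image_mset ?f ((sigma ^^ s) w) = w" if "set_mset w \<subseteq> {1..n}" for w
  proof -
    have "image_mset ?f ((sigma ^^ s) w) = (sigma ^^ 0) w"
    proof (rule image_sigma_pow)
      fix i k assume "i \<in># w" "k < size w"
      then have i: "1 \<le> i" "i \<le> s" using that assms(3) by auto
      then have "(i + k * s - 1) mod s = ((i - 1) + k * s) mod s"
        by (intro arg_cong[where f = "\<lambda>x. x mod s"]) simp
      also have "\<dots> = i - 1" using i by (subst mod_mult_self1) simp
      finally show "?f (i + k * s) = i + k * 0" using i by simp
    qed
    then show ?thesis by simp
  qed
  show ?thesis
    using image_mset_subseteq_mono[OF assms(4), of ?f] assms(1,2) by (simp only: decode)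
qed

section \<open>Minimal generators of the iterated ideals\<close>

definition minimal_monomials :: "nat multiset set \<Rightarrow> nat multiset set" where
  "minimal_monomials S = {u \<in> S. \<forall>v\<in>S. v \<subseteq># u \<longrightarrow> v = u}"

lemma min_gens_Idl:
  assumes "\<forall>u\<in>S. set_mset u \<subseteq> {1..N}"
  shows "min_gens (Idl\<^bsub>T_ring N\<^esub> (xmon ` S) :: 'k::field mpoly set) = minimal_monomials S"
proof -
  interpret cring "T_ring N :: 'k mpoly ring" by (rule cring_T_ring)
  let ?J = "Idl\<^bsub>T_ring N\<^esub> (xmon ` S) :: 'k mpoly set"
  have "xmon ` S \<subseteq> (carrier (T_ring N) :: 'k mpoly set)" using assms by auto
  then have self: "(xmon u :: 'k mpoly) \<in> ?J" if "u \<in> S" for u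
    using genideal_self that by blast
  show ?thesis
  proof
    show "min_gens ?J \<subseteq> minimal_monomials S"
      using min_gens_least[OF assms, where 'k = 'k] self
      by (auto simp: minimal_monomials_def min_gens_def)
    show "minimal_monomials S \<subseteq> min_gens ?J"
    proof
      fix u assume u: "u \<in> minimal_monomials S"
      have "v = u" if v: "(xmon v :: 'k mpoly) \<in> ?J" "v \<subseteq># u" for v
      proof -
        obtain s where s: "s \<in> S" "s \<subseteq># v" using xmon_in_IdlD[OF assms v(1)] by blast
        then have "s = u" using u v(2) by (auto simp: minimal_monomials_def)
        then show ?thesis using s(2) v(2) by simp
      qed
      then show "u \<in> min_gens ?J" using u self by (auto simp: min_gens_def minimal_monomials_def)
    qed
  qed
qed

definition iterated_minimal :: "nat multiset set \<Rightarrow> nat \<Rightarrow> nat multiset set" where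
  "iterated_minimal G s = ((\<lambda>H. minimal_monomials (sigma ` H)) ^^ s) G"

lemma iterated_minimal_0 [simp]: "iterated_minimal G 0 = G"
  and iterated_minimal_Suc [simp]:
    "iterated_minimal G (Suc s) = minimal_monomials (sigma ` iterated_minimal G s)"
  by (simp_all add: iterated_minimal_def)

lemma iterated_minimal_subset: "iterated_minimal G s \<subseteq> (sigma ^^ s) ` G"
proof (induction s)
  case (Suc s)
  have "iterated_minimal G (Suc s) \<subseteq> sigma ` iterated_minimal G s"
    by (auto simp: minimal_monomials_def)
  also have "\<dots> \<subseteq> sigma ` (sigma ^^ s) ` G" using Suc by (rule image_mono)
  finally show ?case by (simp add: image_comp)
qed simp

text \<open>From step \<open>n\<close> on, \<open>\<sigma>\<^sup>s\<close> reflects divisibility and therefore maps an antichain to an antichain,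
  so that passing to minimal monomials no longer removes anything.\<close>

lemma iterated_minimal_stable:
  assumes "\<forall>u\<in>G. set_mset u \<subseteq> {1..n}" "\<forall>u\<in>G. \<forall>v\<in>G. v \<subseteq># u \<longrightarrow> v = u"
  obtains A where "A \<subseteq> G" "\<And>s. s \<ge> n \<Longrightarrow> iterated_minimal G s = (sigma ^^ s) ` A"
proof -
  obtain A where A: "A \<subseteq> G" "iterated_minimal G n = (sigma ^^ n) ` A"
    using iterated_minimal_subset by (rule subset_imageE)
  have "iterated_minimal G s = (sigma ^^ s) ` A" if "s \<ge> n" for s
    using that
  proof (induction s rule: dec_induct)
    case (step s)
    have "v = u" if "u \<in> A" "v \<in> A" "(sigma ^^ Suc s) v \<subseteq># (sigma ^^ Suc s) u" for u v
    proof -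
      have "v \<subseteq># u"
        by (rule sigma_pow_dvdD[OF _ _ _ that(3)]) (use that assms(1) A(1) step.hyps in auto)
      then show ?thesis using that assms(2) A(1) by blast
    qed
    then have "minimal_monomials ((sigma ^^ Suc s) ` A) = (sigma ^^ Suc s) ` A"
      unfolding minimal_monomials_def by blast
    then show ?case using step.IH by (simp add: image_comp)
  qed (use A(2) in simp)
  with A(1) show ?thesis by (rule that)
qed

lemma sigma_pow_ideal_Suc:
  "sigma_pow_ideal N (Suc s) I
    = Idl\<^bsub>T_ring N\<^esub> (xmon ` sigma ` min_gens (sigma_pow_ideal N s I))"
  by (simp add: sigma_pow_ideal_def sigma_ideal_def)

lemma min_gens_sigma_pow_ideal:
  fixes I :: "'k::field mpoly set"
  assumes "\<And>u r. u \<in> min_gens I \<Longrightarrow> r \<le> s \<Longrightarrow> set_mset ((sigma ^^ r) u) \<subseteq> {1..N}"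
  shows "min_gens (sigma_pow_ideal N s I) = iterated_minimal (min_gens I) s"
  using assms
proof (induction s)
  case 0
  show ?case by (simp add: sigma_pow_ideal_def)
next
  case (Suc s)
  have IH: "min_gens (sigma_pow_ideal N s I) = iterated_minimal (min_gens I) s"
    using Suc by simp
  have "set_mset u \<subseteq> {1..N}" if u: "u \<in> sigma ` iterated_minimal (min_gens I) s" for u
  proof -
    obtain v where "v \<in> min_gens I" "u = sigma ((sigma ^^ s) v)"
      using u iterated_minimal_subset[of "min_gens I" s] by blast
    then have "v \<in> min_gens I" "u = (sigma ^^ Suc s) v" by simp_all
    then show ?thesis using Suc.prems by blast
  qed
  then show ?case by (simp add: sigma_pow_ideal_Suc IH min_gens_Idl)
qed

text \<open>The case \<open>s = 0\<close> has to be excluded, since \<open>I\<close> itself need not be an ideal of \<open>T_N\<close>.\<close>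

lemma sigma_pow_ideal_eq_Idl:
  fixes I :: "'k::field mpoly set"
  assumes "\<And>u r. u \<in> min_gens I \<Longrightarrow> r \<le> s \<Longrightarrow> set_mset ((sigma ^^ r) u) \<subseteq> {1..N}" "s \<ge> 1"
  shows "sigma_pow_ideal N s I = Idl\<^bsub>T_ring N\<^esub> (xmon ` iterated_minimal (min_gens I) s)"
proof -
  obtain r where s: "s = Suc r" using assms(2) by (cases s) auto
  have "min_gens (sigma_pow_ideal N r I) = iterated_minimal (min_gens I) r"
    using assms(1) s by (intro min_gens_sigma_pow_ideal) simp
  then have "sigma ` min_gens (sigma_pow_ideal N r I) \<subseteq> (sigma ^^ s) ` min_gens I"
    using iterated_minimal_subset[of "min_gens I" r] unfolding s by auto
  then have "monomial_ideal N (sigma_pow_ideal N s I)"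
    unfolding monomial_ideal_def s sigma_pow_ideal_Suc using assms(1)[of _ s] s by blast
  from Idl_min_gens[OF this] show ?thesis by (simp add: min_gens_sigma_pow_ideal[OF assms(1)])
qed

section \<open>Images of ideals under algebra homomorphisms\<close>

lemma Idl_image_Idl:
  assumes "ring R" "ring S" "h \<in> ring_hom R S" "X \<subseteq> carrier R"
  shows "Idl\<^bsub>S\<^esub> (h ` (Idl\<^bsub>R\<^esub> X)) = Idl\<^bsub>S\<^esub> (h ` X)"
proof -
  interpret R: ring R by fact
  interpret S: ring S by fact
  interpret ring_hom_ring R S h by (rule ring_hom_ringI2) fact+
  have hX: "h ` X \<subseteq> carrier S" using assms(4) by auto
  interpret J: ideal "Idl\<^bsub>S\<^esub> (h ` X)" S by (rule S.genideal_ideal[OF hX])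
  \<comment> \<open>The elements that \<open>h\<close> maps into the ideal generated by \<open>h ` X\<close> form an ideal containing \<open>X\<close>.\<close>
  have "ideal {r \<in> carrier R. h r \<in> Idl\<^bsub>S\<^esub> (h ` X)} R"
  proof (rule idealI[OF R.ring_axioms])
    show "subgroup {r \<in> carrier R. h r \<in> Idl\<^bsub>S\<^esub> (h ` X)} (add_monoid R)"
      by (rule R.add.subgroupI) (auto intro!: exI[of _ "\<zero>\<^bsub>R\<^esub>"] simp flip: a_inv_def)
  qed (auto intro: J.I_l_closed J.I_r_closed)
  then have "Idl\<^bsub>R\<^esub> X \<subseteq> {r \<in> carrier R. h r \<in> Idl\<^bsub>S\<^esub> (h ` X)}"
    using assms(4) S.genideal_self[OF hX] by (intro R.genideal_minimal) auto
  then have "h ` (Idl\<^bsub>R\<^esub> X) \<subseteq> Idl\<^bsub>S\<^esub> (h ` X)" by auto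
  then have "Idl\<^bsub>S\<^esub> (h ` (Idl\<^bsub>R\<^esub> X)) \<subseteq> Idl\<^bsub>S\<^esub> (h ` X)"
    by (rule S.genideal_minimal[OF J.ideal_axioms])
  moreover have "Idl\<^bsub>R\<^esub> X \<subseteq> carrier R"
    using ideal.Icarr[OF R.genideal_ideal[OF assms(4)]] by blast
  then have "Idl\<^bsub>S\<^esub> (h ` X) \<subseteq> Idl\<^bsub>S\<^esub> (h ` (Idl\<^bsub>R\<^esub> X))"
    using R.genideal_self[OF assms(4)] by (intro S.subset_Idl_subset) auto
  ultimately show ?thesis by blast
qed

lemma K_alg_hom_xmon:
  fixes \<Phi> :: "'k::field mpoly \<Rightarrow> 'k mpoly"
  assumes "K_alg_hom M N \<Phi>" "\<forall>j\<in>{1..M}. \<Phi> (Var j) = Var (f j)" "set_mset u \<subseteq> {1..M}"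
  shows "\<Phi> (xmon u) = xmon (image_mset f u)"
  using assms(3)
proof (induction u)
  case empty
  have "\<Phi> (Const 1) = Const 1" using assms(1) unfolding K_alg_hom_def by blast
  then show ?case by (simp add: xmon_def del: single_one)
next
  case (add j u)
  have "\<Phi> (xmon {#j#} * xmon u) = \<Phi> (xmon {#j#}) * \<Phi> (xmon u)"
    using assms(1) add.prems ring_hom_mult[of \<Phi> "T_ring M" "T_ring N" "xmon {#j#}" "xmon u"]
    by (simp add: K_alg_hom_def)
  then show ?case
    using add assms(2) by (simp flip: xmon_add)
qed

lemma Idl_sigma_pow_image:
  fixes \<Phi> :: "'k::field mpoly \<Rightarrow> 'k mpoly"
  assumes "K_alg_hom (n * d) N \<Phi>" "\<forall>j\<in>{1..n * d}. \<Phi> (Var j) = Var (phi n j t)" "n \<le> t"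
    and "\<And>u. u \<in> A \<Longrightarrow> set_mset u \<subseteq> {1..n} \<and> size u \<le> d"
  shows "Idl\<^bsub>T_ring N\<^esub> (\<Phi> ` (Idl\<^bsub>T_ring (n * d)\<^esub> (xmon ` (sigma ^^ n) ` A)))
    = Idl\<^bsub>T_ring N\<^esub> (xmon ` (sigma ^^ t) ` A)"
proof -
  have range: "set_mset ((sigma ^^ n) u) \<subseteq> {1..n * d}" if "u \<in> A" for u
    using sigma_pow_range[of u n d n n] assms(4)[OF that] by simp
  have "\<Phi> (xmon ((sigma ^^ n) u)) = xmon ((sigma ^^ t) u)" if "u \<in> A" for u
    using K_alg_hom_xmon[OF assms(1,2) range[OF that]]
      image_phi_sigma_pow[of u n t] assms(3) assms(4)[OF that] by simp
  then have "\<Phi> ` xmon ` (sigma ^^ n) ` A = xmon ` (sigma ^^ t) ` A"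
    unfolding image_image by (rule image_cong[OF refl])
  moreover have "xmon ` (sigma ^^ n) ` A \<subseteq> (carrier (T_ring (n * d)) :: 'k mpoly set)"
    using range by auto
  moreover have "\<Phi> \<in> ring_hom (T_ring (n * d)) (T_ring N)"
    using assms(1) by (simp add: K_alg_hom_def)
  ultimately show ?thesis
    using Idl_image_Idl[of "T_ring (n * d)" "T_ring N" \<Phi> "xmon ` (sigma ^^ n) ` A"]
      cring.axioms(1)[OF cring_T_ring] by metis
qed

section \<open>Comparison of the ideals\<close>

theorem proposition1p4:
  fixes I :: "'k::field mpoly set"
    and \<Phi> :: "'k mpoly \<Rightarrow> 'k mpoly"
    and n t d :: nat
  assumes "n \<ge> 1"
    and "monomial_ideal n I"
    and "I \<noteq> {0}"
    and "d = deg_ideal I"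
    and "t \<ge> n"
    and "K_alg_hom (n * d) (t * d) \<Phi>"
    and "\<forall>j\<in>{1..n * d}. \<Phi> (Var j) = Var (phi n j t)"
  shows "sigma_pow_ideal (t * d) t I = Idl\<^bsub>T_ring (t * d)\<^esub> (\<Phi> ` sigma_pow_ideal (n * d) n I) \<and>
         sigma_pow_gen_ideal (t * d) t I = Idl\<^bsub>T_ring (t * d)\<^esub> (\<Phi> ` sigma_pow_gen_ideal (n * d) n I)"
proof -
  obtain S where "\<forall>u\<in>S. set_mset u \<subseteq> {1..n}" "I = Idl\<^bsub>T_ring n\<^esub> (xmon ` S)"
    using assms(2) by (auto simp: monomial_ideal_def)
  then have gens_range: "\<forall>u\<in>min_gens I. set_mset u \<subseteq> {1..n}"
    using min_gens_least[of S n, where 'k = 'k] by blast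
  have gens_deg: "size u \<le> d" if "u \<in> min_gens I" for u
    using finite_min_gens[OF assms(2)] that by (simp add: assms(4) deg_ideal_def)
  have gens: "set_mset u \<subseteq> {1..n} \<and> size u \<le> d" if "u \<in> min_gens I" for u
    using gens_range gens_deg that by blast
  have antichain: "\<forall>u\<in>min_gens I. \<forall>v\<in>min_gens I. v \<subseteq># u \<longrightarrow> v = u"
    by (auto simp: min_gens_def)
  obtain A where A: "A \<subseteq> min_gens I"
      "\<And>s. s \<ge> n \<Longrightarrow> iterated_minimal (min_gens I) s = (sigma ^^ s) ` A"
    using iterated_minimal_stable[OF gens_range antichain] by blast
  have pow: "sigma_pow_ideal (s * d) s I = Idl\<^bsub>T_ring (s * d)\<^esub> (xmon ` (sigma ^^ s) ` A)"
    if "s \<ge> n" for s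
  proof -
    have "sigma_pow_ideal (s * d) s I
        = Idl\<^bsub>T_ring (s * d)\<^esub> (xmon ` iterated_minimal (min_gens I) s)"
    proof (rule sigma_pow_ideal_eq_Idl)
      show "set_mset ((sigma ^^ r) u) \<subseteq> {1..s * d}" if "u \<in> min_gens I" "r \<le> s" for u r
        using sigma_pow_range[of u n d r s] gens that \<open>s \<ge> n\<close> by blast
    qed (use assms(1) that in simp)
    then show ?thesis using A(2)[OF that] by simp
  qed
  note image = Idl_sigma_pow_image[OF assms(6,7,5)]
  have "Idl\<^bsub>T_ring (t * d)\<^esub> (\<Phi> ` sigma_pow_ideal (n * d) n I) = sigma_pow_ideal (t * d) t I"
    unfolding pow[OF order_refl] pow[OF assms(5)] by (rule image) (use A(1) gens in blast)
  moreover have "Idl\<^bsub>T_ring (t * d)\<^esub> (\<Phi> ` sigma_pow_gen_ideal (n * d) n I)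
      = sigma_pow_gen_ideal (t * d) t I"
    unfolding sigma_pow_gen_ideal_def by (rule image) (rule gens)
  ultimately show ?thesis by simp
qed

end
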